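(* Let $l,h\ge 0$ be integers with $l+h\ge 1$. The game $D_{l,h}^+$ is equivalent to the normal play of the game of Nim with one pile of size $l+h-1$. The game $DM_{l,h}^+$ is equivalent to the mis\`ere play of the game of Nim with one pile of size $l+h-1$.
   Context: Coin games. There is a finite collection of identically-looking coins, exactly one of which is counterfeit; all real coins weigh the same. A weighing puts equal numbers of coins on the two pans of a balance scale; its outcome (balance, left lighter, right lighter) is seen by an Observer, who is a perfect reasoner and remembers all weighings. Two players, who know exactly which coin is counterfeit and whether it is heavier or lighter, alternate turns; a move is one weighing that gives the Observer some new information (i.e. strictly shrinks the set of possibilities for the counterfeit coin that are consistent with everything the Observer has seen). Destined coins. In $D_{l,h}^+$ and $DM_{l,h}^+$ there are $N=l+h$ coins, of which $l$ have lighter destiny and $h$ have heavier destiny, together with one extra coin known to everybody to be real (it may be used in weighings). The counterfeit coin is one of the $N$ coins; the Observer knows each coin's destiny, and knows that if the counterfeit coin is among the $l$ coins it is lighter than a real coin, and if it is among the $h$ coins it is heavier. The Observer's goal is to find the counterfeit coin. A coin is excluded once the weighings prove it real: if a weighing balances, all coins on the scale are excluded; if it does not balance, the lighter-destined coins on the heavier pan, the heavier-destined coins on the lighter pan, and the coins not on the scale are excluded. Other coins keep their destinies. End of game. $D_{l,h}^+$ is normal play: the game ends when the Observer reaches her goal, and the player who reveals the last necessary piece of information wins. $DM_{l,h}^+$ is mis\`ere play: the player who reveals the full information loses. Equivalence with Nim. A one-pile Nim game of size $n$ allows a player to replace the pile by any strictly smaller pile of size $\ge 0$; in normal play the player who moves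 to size $0$ wins, in mis\`ere play that player loses. A coin game is equivalent to one-pile Nim of size $n$ (with the same play convention) if one can assign a pile size to each of its reachable positions so that the starting position has pile size $n$, the positions in which the Observer has reached her goal are exactly those of pile size $0$, and from a position of pile size $m$ the legal moves lead to positions of each pile size $0,1,\dots,m-1$ and to no others. *)

theory Defs
  imports Main
begin

text \<open>
  Who has won a game that is over. In normal play the player who made the ending move wins, in
  misere play that player loses.
\<close>

datatype player = Last_mover | Opponent_of_last_mover

datatype convention = Normal | Misere

fun winner_at_end :: "convention \<Rightarrow> player" where
  "winner_at_end Normal = Last_mover"
| "winner_at_end Misere = Opponent_of_last_mover"

text \<open>
  \<open>verdict G p\<close> is \<open>None\<close> while the game goes on and names the winner once it is over at \<open>p\<close>, so
  that the play convention is part of the game.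
\<close>

record 'p game =
  start :: 'p
  move :: "'p \<Rightarrow> 'p \<Rightarrow> bool"
  verdict :: "'p \<Rightarrow> player option"

definition reachable :: "'p game \<Rightarrow> 'p \<Rightarrow> bool" where
  "reachable G p \<longleftrightarrow> rtranclp (move G) (start G) p"

definition nim :: "convention \<Rightarrow> nat \<Rightarrow> nat game" where
  "nim v n =
    \<lparr> start = n,
      move = (\<lambda>m k. k < m),
      verdict = (\<lambda>m. if m = 0 then Some (winner_at_end v) else None) \<rparr>"

definition equivalent :: "'p game \<Rightarrow> nat game \<Rightarrow> bool" where
  "equivalent G N \<longleftrightarrow>
    (\<exists>pile. pile (start G) = start N \<and>
      (\<forall>p. reachable G p \<longrightarrow>
        verdict G p = verdict N (pile p) \<and>
        {pile q |q. move G p q} = {k. move N (pile p) k}))"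

lemma equivalent_nim_iff:
  "equivalent G (nim v n) \<longleftrightarrow>
    (\<exists>pile. pile (start G) = n \<and>
      (\<forall>p. reachable G p \<longrightarrow>
        verdict G p = (if pile p = 0 then Some (winner_at_end v) else None) \<and>
        {pile q |q. move G p q} = {..<pile p}))"
  by (simp add: equivalent_def nim_def lessThan_def)

text \<open>\<open>Extra\<close> is the additional coin that everybody knows to be real.\<close>

datatype coin = Lighter nat | Heavier nat | Extra

definition destined :: "nat \<Rightarrow> nat \<Rightarrow> coin set" where
  "destined l h = Lighter ` {..<l} \<union> Heavier ` {..<h}"

type_synonym weighing = "coin set \<times> coin set"

definition weighings :: "nat \<Rightarrow> nat \<Rightarrow> weighing set" where
  "weighings l h =
    {(A, B). A \<union> B \<subseteq> insert Extra (destined l h) \<and> A \<inter> B = {} \<and> card A = card B}"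

datatype outcome = Balance | Left_lighter | Right_lighter

text \<open>
  The outcome of weighing \<open>A\<close> (left pan) against \<open>B\<close> (right pan) if the given coin is the
  counterfeit one. As the pans carry equal numbers of coins, only its place and destiny matter.
\<close>

fun outcome_if :: "coin \<Rightarrow> weighing \<Rightarrow> outcome" where
  "outcome_if (Lighter i) (A, B) =
    (if Lighter i \<in> A then Left_lighter
     else if Lighter i \<in> B then Right_lighter else Balance)"
| "outcome_if (Heavier i) (A, B) =
    (if Heavier i \<in> A then Right_lighter
     else if Heavier i \<in> B then Left_lighter else Balance)"
| "outcome_if Extra (A, B) = Balance"

text \<open>What the Observer has seen, most recent weighing first.\<close>

type_synonym history = "(weighing \<times> outcome) list"

definition possibilities :: "nat \<Rightarrow> nat \<Rightarrow> history \<Rightarrow> coin set" where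
  "possibilities l h H = {x \<in> destined l h. \<forall>(w, r) \<in> set H. outcome_if x w = r}"

text \<open>
  The next lemma is the rule by which coins get excluded. Each outcome of a new weighing leaves
  exactly the coins listed.
\<close>

lemma possibilities_Cons:
  assumes "A \<inter> B = {}"
  shows "possibilities l h (((A, B), Balance) # H) = possibilities l h H - (A \<union> B)"
    and "possibilities l h (((A, B), Left_lighter) # H) =
      possibilities l h H \<inter> (A \<union> B) - (A \<inter> range Heavier \<union> B \<inter> range Lighter)"
    and "possibilities l h (((A, B), Right_lighter) # H) =
      possibilities l h H \<inter> (A \<union> B) - (A \<inter> range Lighter \<union> B \<inter> range Heavier)"
  using assms by (auto simp: possibilities_def destined_def split: if_splits)

text \<open>
  The players know the counterfeit coin \<open>c\<close>, which therefore is a parameter of the game and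
  determines the outcome of every weighing. Positions are histories. No weighing is a move once
  only one possibility remains, because \<open>c\<close> itself is never excluded.
\<close>

definition coin_move :: "nat \<Rightarrow> nat \<Rightarrow> coin \<Rightarrow> history \<Rightarrow> history \<Rightarrow> bool" where
  "coin_move l h c H H' \<longleftrightarrow>
    (\<exists>w \<in> weighings l h. H' = (w, outcome_if c w) # H \<and>
      possibilities l h H' \<subset> possibilities l h H)"

definition coin_game :: "convention \<Rightarrow> nat \<Rightarrow> nat \<Rightarrow> coin \<Rightarrow> history game" where
  "coin_game v l h c =
    \<lparr> start = [],
      move = coin_move l h c,
      verdict = (\<lambda>H. if is_singleton (possibilities l h H)
                     then Some (winner_at_end v) else None) \<rparr>"

definition D_plus :: "nat \<Rightarrow> nat \<Rightarrow> coin \<Rightarrow> history game" where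
  "D_plus = coin_game Normal"

definition DM_plus :: "nat \<Rightarrow> nat \<Rightarrow> coin \<Rightarrow> history game" where
  "DM_plus = coin_game Misere"

end

theory Submission
  imports Defs
begin

text \<open>
  Take as pile size the number of coins not yet excluded, minus one. The counterfeit coin is never
  excluded, so every move lowers the pile size without making it negative, and pile size 0 means
  that the counterfeit coin has been found. Conversely, any set \<open>T\<close> of coins avoiding the
  counterfeit one can be excluded by a single balanced weighing (lemma
  \<open>weighing_excluding\<close>): split \<open>T\<close> evenly between the pans, adding the extra coin first if \<open>T\<close>
  has odd size. Hence every smaller pile size is reached in one move. The argument does not depend
  on the play convention.
\<close>

lemma finite_destined: "finite (destined l h)"
  by (simp add: destined_def)

lemma card_destined: "card (destined l h) = l + h"
  unfolding destined_def
  by (subst card_Un_disjoint) (auto simp: card_image inj_on_def)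

lemma Extra_not_destined: "Extra \<notin> destined l h"
  by (auto simp: destined_def)

lemma possibilities_subset_destined: "possibilities l h H \<subseteq> destined l h"
  by (auto simp: possibilities_def)

lemma finite_possibilities: "finite (possibilities l h H)"
  using finite_subset[OF possibilities_subset_destined finite_destined] .

lemma outcome_if_not_weighed: "c \<notin> A \<union> B \<Longrightarrow> outcome_if c (A, B) = Balance"
  by (cases c) auto

lemma split_even:
  assumes "finite S" "even (card S)"
  obtains A B where "A \<union> B = S" "A \<inter> B = {}" "card A = card B"
proof -
  obtain A where A: "A \<subseteq> S" "card A = card S div 2" "finite A"
    using obtain_subset_with_card_n[of "card S div 2" S] by auto
  have "card (S - A) = card S - card S div 2"
    using A by (simp add: card_Diff_subset)
  also have "\<dots> = card A"
    using A(2) assms(2) by presburger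
  finally show ?thesis
    using that[of A "S - A"] A(1) by auto
qed

lemma weighing_excluding:
  assumes T: "T \<subseteq> destined l h" and c: "c \<in> destined l h - T"
  obtains w where "w \<in> weighings l h" "outcome_if c w = Balance"
    "\<And>H. possibilities l h ((w, Balance) # H) = possibilities l h H - T"
proof -
  define S where "S = (if even (card T) then T else insert Extra T)"
  have fin: "finite T" and ext: "Extra \<notin> T"
    using T finite_destined finite_subset Extra_not_destined by blast+
  have "finite S" "even (card S)"
    using fin ext by (auto simp: S_def)
  then obtain A B where AB: "A \<union> B = S" "A \<inter> B = {}" "card A = card B"
    by (rule split_even)
  have S: "T \<subseteq> S" "S \<subseteq> insert Extra T"
    by (auto simp: S_def)
  show ?thesis
  proof
    show "(A, B) \<in> weighings l h"
      using AB S T by (auto simp: weighings_def)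
    show "outcome_if c (A, B) = Balance"
      using AB(1) S(2) c Extra_not_destined by (intro outcome_if_not_weighed) auto
    show "possibilities l h (((A, B), Balance) # H) = possibilities l h H - T" for H
      using possibilities_Cons(1)[OF AB(2)] AB(1) S Extra_not_destined
        possibilities_subset_destined by blast
  qed
qed

lemma counterfeit_possible:
  assumes "c \<in> destined l h" "reachable (coin_game v l h c) H"
  shows "c \<in> possibilities l h H"
proof -
  have "rtranclp (coin_move l h c) [] H"
    using assms(2) by (simp add: reachable_def coin_game_def)
  then show ?thesis
    by induction (use assms(1) in \<open>auto simp: coin_move_def possibilities_def\<close>)
qed

text \<open>The moves of the coin game realise exactly the Nim moves.\<close>

lemma pile_sizes_after_move:
  assumes c: "c \<in> possibilities l h H"
  shows "{card (possibilities l h H') - 1 |H'. coin_move l h c H H'} =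
    {..<card (possibilities l h H) - 1}"
    (is "?L = {..<card ?P - 1}")
proof (intro equalityI subsetI)
  fix k assume "k \<in> ?L"
  then obtain H' where k: "k = card (possibilities l h H') - 1" and m: "coin_move l h c H H'"
    by auto
  have sub: "possibilities l h H' \<subset> ?P" and "c \<in> possibilities l h H'"
    using m c by (auto simp: coin_move_def possibilities_def)
  then have "card (possibilities l h H') \<ge> 1"
    using finite_possibilities by (metis One_nat_def Suc_leI card_gt_0_iff empty_iff)
  moreover have "card (possibilities l h H') < card ?P"
    using sub finite_possibilities by (rule psubset_card_mono[rotated])
  ultimately show "k \<in> {..<card ?P - 1}"
    using k by auto
next
  fix k assume "k \<in> {..<card ?P - 1}"
  then have k: "k < card ?P - 1" by simp
  have cD: "card (?P - {c}) = card ?P - 1"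
    using c by simp
  \<comment> \<open>The coins to exclude: all but \<open>c\<close> and \<open>k\<close> further possibilities.\<close>
  obtain T where T: "T \<subseteq> ?P - {c}" "card T = card ?P - 1 - k" "finite T"
    using obtain_subset_with_card_n[of "card ?P - 1 - k" "?P - {c}"] cD diff_le_self by metis
  obtain w where w: "w \<in> weighings l h" "outcome_if c w = Balance"
    and poss: "\<And>H. possibilities l h ((w, Balance) # H) = possibilities l h H - T"
    using weighing_excluding[of T l h c] T(1) c possibilities_subset_destined by blast
  have "T \<noteq> {}"
    using T(2) k by auto
  then have "?P - T \<subset> ?P"
    using T(1) by blast
  then have "coin_move l h c H ((w, Balance) # H)"
    using w poss by (auto simp: coin_move_def)
  moreover have "card (?P - T) - 1 = k"
  proof -
    have "T \<subseteq> ?P" using T(1) by blast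
    then show ?thesis
      using T(2,3) k by (simp add: card_Diff_subset)
  qed
  ultimately show "k \<in> ?L"
    using poss by (smt (verit) mem_Collect_eq)
qed

lemma coin_game_equivalent_nim:
  assumes c: "c \<in> destined l h"
  shows "equivalent (coin_game v l h c) (nim v (l + h - 1))"
  unfolding equivalent_nim_iff
proof (intro exI[of _ "\<lambda>H. card (possibilities l h H) - 1"] conjI allI impI)
  show "card (possibilities l h (start (coin_game v l h c))) - 1 = l + h - 1"
    using card_destined by (simp add: coin_game_def possibilities_def)
next
  fix H assume "reachable (coin_game v l h c) H"
  then have cH: "c \<in> possibilities l h H"
    using counterfeit_possible c by blast
  then have "card (possibilities l h H) \<noteq> 0"
    using finite_possibilities by auto
  then have "is_singleton (possibilities l h H) \<longleftrightarrow> card (possibilities l h H) - 1 = 0"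
    by (auto simp: is_singleton_altdef)
  then show "verdict (coin_game v l h c) H =
      (if card (possibilities l h H) - 1 = 0 then Some (winner_at_end v) else None)"
    by (simp add: coin_game_def)
  show "{card (possibilities l h H') - 1 |H'. move (coin_game v l h c) H H'} =
      {..<card (possibilities l h H) - 1}"
    using pile_sizes_after_move[OF cH] by (simp add: coin_game_def)
qed

theorem lemma1:
  fixes l h :: nat
  assumes "l + h \<ge> 1"
  shows "(\<forall>c \<in> destined l h. equivalent (D_plus l h c) (nim Normal (l + h - 1))) \<and>
         (\<forall>c \<in> destined l h. equivalent (DM_plus l h c) (nim Misere (l + h - 1)))"
  unfolding D_plus_def DM_plus_def by (blast intro: coin_game_equivalent_nim)

end
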